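(* Let $(X,d_{\mathbb{D}})$ be a $\mathbb{D}$-complete $\mathbb{D}$-metric space and let $T:X\to X$ be a $\mathbb{D}$-contraction mapping having $\mathbb{D}$-Lipschitz constant $k$, $0\prec k\prec 1$. Then $T$ has a unique fixed point $x_0$ (i.e. $T(x_0)=x_0$), and for each $x\in X$, $\lim_{n\to\infty}T^n(x)=x_0$. Moreover, for each $x\in X$ and $n\in\mathbb{N}$, $$d_{\mathbb{D}}(T^n(x),x_0)\preceq \frac{k^n}{1-k}\,d_{\mathbb{D}}(x,T(x)).$$
   Context: Hyperbolic numbers: $\mathbb{D}=\{a_1+\mathbf{k}a_2: a_1,a_2\in\mathbb{R}\}$ with $\mathbf{k}^2=1$, a commutative ring. With $\mathbf{e}_1=\frac{1+\mathbf{k}}{2}$, $\mathbf{e}_2=\frac{1-\mathbf{k}}{2}$, every $\alpha\in\mathbb{D}$ is uniquely $\alpha=\alpha_1\mathbf{e}_1+\alpha_2\mathbf{e}_2$ with $\alpha_1,\alpha_2\in\mathbb{R}$; sums, products (and inverses/quotients, when both components of the divisor are nonzero) are computed componentwise, and $1=\mathbf{e}_1+\mathbf{e}_2$. Write $\alpha\preceq\beta$ if $\alpha_1\le\beta_1$ and $\alpha_2\le\beta_2$, and $\alpha\prec\beta$ if $\alpha_1<\beta_1$ and $\alpha_2<\beta_2$. Let $\mathbb{D}^+=\{\alpha:\alpha_1,\alpha_2>0\}$ and $\mathbb{D}_0^+=\{\alpha:\alpha_1,\alpha_2\ge 0\}$. A $\mathbb{D}$-metric on a nonempty set $X$ is a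 function $d_{\mathbb{D}}:X\times X\to\mathbb{D}_0^+$ such that for all $x,y,z\in X$: $d_{\mathbb{D}}(x,y)=0$ iff $x=y$; $d_{\mathbb{D}}(x,y)=d_{\mathbb{D}}(y,x)$; $d_{\mathbb{D}}(x,y)\preceq d_{\mathbb{D}}(x,z)+d_{\mathbb{D}}(z,y)$. Then $(X,d_{\mathbb{D}})$ is a $\mathbb{D}$-metric space. A sequence $\{x_n\}$ in $X$ converges to $\alpha\in X$ (written $\lim_{n\to\infty} x_n=\alpha$) if for every $\epsilon\in\mathbb{D}^+$ there is $N\in\mathbb{N}$ with $d_{\mathbb{D}}(x_n,\alpha)\prec\epsilon$ for all $n\ge N$. It is $\mathbb{D}$-Cauchy if for every $\epsilon\in\mathbb{D}^+$ there is $N$ with $d_{\mathbb{D}}(x_n,x_m)\prec\epsilon$ for all $n,m\ge N$. $(X,d_{\mathbb{D}})$ is $\mathbb{D}$-complete if every $\mathbb{D}$-Cauchy sequence converges to a point of $X$. A mapping $T:X\to X$ is $\mathbb{D}$-Lipschitzian if there is $k\in\mathbb{D}^+$ such that $d_{\mathbb{D}}(Tx,Ty)\preceq k\,d_{\mathbb{D}}(x,y)$ for all $x,y\in X$; the smallest $k$ satisfying this is called the $\mathbb{D}$-Lipschitz constant of $T$. A $\mathbb{D}$-contraction mapping is a $\mathbb{D}$-Lipschitzian mapping $T:X\to X$ with $\mathbb{D}$-Lipschitz constant $k$ satisfying $0\prec k\prec 1$. $T^n$ denotes the $n$-fold iterate of $T$. *)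

theory Defs
  imports Complex_Main "HOL-Library.FuncSet"
begin

text \<open>\<open>Hyp a b\<close> stands for $a + \mathbf{k} b$ with $\mathbf{k}^2 = 1$.\<close>

datatype hyperbolic = Hyp (hyp_fst: real) (hyp_snd: real)

instantiation hyperbolic :: real_algebra_1
begin

definition "0 = Hyp 0 0"
definition "1 = Hyp 1 0"
definition "x + y = Hyp (hyp_fst x + hyp_fst y) (hyp_snd x + hyp_snd y)"
definition "x - y = Hyp (hyp_fst x - hyp_fst y) (hyp_snd x - hyp_snd y)"
definition "- x = Hyp (- hyp_fst x) (- hyp_snd x)"
definition "x * y = Hyp (hyp_fst x * hyp_fst y + hyp_snd x * hyp_snd y)
                        (hyp_fst x * hyp_snd y + hyp_snd x * hyp_fst y)"
definition "r *\<^sub>R x = Hyp (r * hyp_fst x) (r * hyp_snd x)"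

lemmas hyperbolic_defs =
  zero_hyperbolic_def one_hyperbolic_def plus_hyperbolic_def minus_hyperbolic_def
  uminus_hyperbolic_def times_hyperbolic_def scaleR_hyperbolic_def

instance
  by standard (auto simp: hyperbolic_defs algebra_simps)

end

instance hyperbolic :: comm_ring_1
  by standard (auto simp: hyperbolic_defs algebra_simps)

definition hyp_k :: hyperbolic where "hyp_k = Hyp 0 1"

definition e1 :: hyperbolic where "e1 = (1/2) *\<^sub>R (1 + hyp_k)"

definition e2 :: hyperbolic where "e2 = (1/2) *\<^sub>R (1 - hyp_k)"

text \<open>Coordinates with respect to the idempotent basis \<open>e1\<close>, \<open>e2\<close>; see
  \<open>hyp_decomp_iff\<close> below.\<close>

definition comp1 :: "hyperbolic \<Rightarrow> real" where "comp1 x = hyp_fst x + hyp_snd x"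

definition comp2 :: "hyperbolic \<Rightarrow> real" where "comp2 x = hyp_fst x - hyp_snd x"

text \<open>The inverse is only meaningful if both components are nonzero; on zero divisors it
  takes junk values, following the convention $1/0 = 0$ on the reals.\<close>

instantiation hyperbolic :: inverse
begin

definition inverse_hyperbolic :: "hyperbolic \<Rightarrow> hyperbolic"
  where "inverse x = (1 / comp1 x) *\<^sub>R e1 + (1 / comp2 x) *\<^sub>R e2"

definition divide_hyperbolic :: "hyperbolic \<Rightarrow> hyperbolic \<Rightarrow> hyperbolic"
  where "x div y = x * inverse (y :: hyperbolic)"

instance ..

end

lemma hyp_k_square: "hyp_k * hyp_k = 1"
  by (simp add: hyp_k_def hyperbolic_defs)

lemma hyp_eq_k: "Hyp a b = of_real a + hyp_k * of_real b"
  by (simp add: hyp_k_def of_real_def hyperbolic_defs)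

lemma e1_plus_e2: "e1 + e2 = 1"
  by (simp add: e1_def e2_def hyp_k_def hyperbolic_defs)

lemma hyp_decomp_iff: "x = a *\<^sub>R e1 + b *\<^sub>R e2 \<longleftrightarrow> a = comp1 x \<and> b = comp2 x"
  by (cases x) (auto simp: e1_def e2_def hyp_k_def comp1_def comp2_def hyperbolic_defs field_simps)

lemma hyperbolic_eq_iff: "x = y \<longleftrightarrow> comp1 x = comp1 y \<and> comp2 x = comp2 y"
  by (metis hyp_decomp_iff)

lemma comp_simps [simp]:
  "comp1 0 = 0" "comp2 0 = 0"
  "comp1 1 = 1" "comp2 1 = 1"
  "comp1 e1 = 1" "comp2 e1 = 0"
  "comp1 e2 = 0" "comp2 e2 = 1"
  "comp1 (x + y) = comp1 x + comp1 y" "comp2 (x + y) = comp2 x + comp2 y"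
  "comp1 (x - y) = comp1 x - comp1 y" "comp2 (x - y) = comp2 x - comp2 y"
  "comp1 (- x) = - comp1 x" "comp2 (- x) = - comp2 x"
  "comp1 (x * y) = comp1 x * comp1 y" "comp2 (x * y) = comp2 x * comp2 y"
  "comp1 (r *\<^sub>R x) = r * comp1 x" "comp2 (r *\<^sub>R x) = r * comp2 x"
  by (simp_all add: comp1_def comp2_def e1_def e2_def hyp_k_def hyperbolic_defs algebra_simps)

lemma comp_power [simp]: "comp1 (x ^ n) = comp1 x ^ n" "comp2 (x ^ n) = comp2 x ^ n"
  by (induction n) simp_all

lemma comp_inverse [simp]:
  "comp1 (inverse x) = inverse (comp1 x)" "comp2 (inverse x) = inverse (comp2 x)"
  by (simp_all add: inverse_hyperbolic_def field_simps)

lemma comp_divide [simp]: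
  "comp1 (x / y) = comp1 x / comp1 y" "comp2 (x / y) = comp2 x / comp2 y"
  by (simp_all add: divide_hyperbolic_def field_simps)

lemma hyp_right_inverse: "comp1 x \<noteq> 0 \<Longrightarrow> comp2 x \<noteq> 0 \<Longrightarrow> x * inverse x = 1"
  by (simp add: hyperbolic_eq_iff)

text \<open>The strict relation is \<^emph>\<open>not\<close> the irreflexive part of \<open>\<preceq>\<close>: both components must
  be strictly smaller. Hence these are not instances of the order classes.\<close>

definition hyp_le :: "hyperbolic \<Rightarrow> hyperbolic \<Rightarrow> bool"  (infix "\<preceq>" 50)
  where "x \<preceq> y \<longleftrightarrow> comp1 x \<le> comp1 y \<and> comp2 x \<le> comp2 y"

definition hyp_less :: "hyperbolic \<Rightarrow> hyperbolic \<Rightarrow> bool"  (infix "\<prec>" 50)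
  where "x \<prec> y \<longleftrightarrow> comp1 x < comp1 y \<and> comp2 x < comp2 y"

definition D_pos :: "hyperbolic set"
  where "D_pos = {x. comp1 x > 0 \<and> comp2 x > 0}"

definition D_nonneg :: "hyperbolic set"
  where "D_nonneg = {x. comp1 x \<ge> 0 \<and> comp2 x \<ge> 0}"

definition D_metric_space :: "'a set \<Rightarrow> ('a \<Rightarrow> 'a \<Rightarrow> hyperbolic) \<Rightarrow> bool"
  where "D_metric_space X d \<longleftrightarrow>
    X \<noteq> {} \<and>
    (\<forall>x\<in>X. \<forall>y\<in>X. d x y \<in> D_nonneg) \<and>
    (\<forall>x\<in>X. \<forall>y\<in>X. d x y = 0 \<longleftrightarrow> x = y) \<and>
    (\<forall>x\<in>X. \<forall>y\<in>X. d x y = d y x) \<and>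
    (\<forall>x\<in>X. \<forall>y\<in>X. \<forall>z\<in>X. d x y \<preceq> d x z + d z y)"

definition D_converges :: "('a \<Rightarrow> 'a \<Rightarrow> hyperbolic) \<Rightarrow> (nat \<Rightarrow> 'a) \<Rightarrow> 'a \<Rightarrow> bool"
  where "D_converges d s l \<longleftrightarrow> (\<forall>\<epsilon>\<in>D_pos. \<exists>N. \<forall>n\<ge>N. d (s n) l \<prec> \<epsilon>)"

definition D_Cauchy :: "('a \<Rightarrow> 'a \<Rightarrow> hyperbolic) \<Rightarrow> (nat \<Rightarrow> 'a) \<Rightarrow> bool"
  where "D_Cauchy d s \<longleftrightarrow> (\<forall>\<epsilon>\<in>D_pos. \<exists>N. \<forall>n\<ge>N. \<forall>m\<ge>N. d (s n) (s m) \<prec> \<epsilon>)"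

definition D_complete :: "'a set \<Rightarrow> ('a \<Rightarrow> 'a \<Rightarrow> hyperbolic) \<Rightarrow> bool"
  where "D_complete X d \<longleftrightarrow>
    (\<forall>s. range s \<subseteq> X \<longrightarrow> D_Cauchy d s \<longrightarrow> (\<exists>l\<in>X. D_converges d s l))"

definition D_Lipschitz_bound ::
    "'a set \<Rightarrow> ('a \<Rightarrow> 'a \<Rightarrow> hyperbolic) \<Rightarrow> ('a \<Rightarrow> 'a) \<Rightarrow> hyperbolic \<Rightarrow> bool"
  where "D_Lipschitz_bound X d T k \<longleftrightarrow>
    k \<in> D_pos \<and> (\<forall>x\<in>X. \<forall>y\<in>X. d (T x) (T y) \<preceq> k * d x y)"

definition D_Lipschitzian ::
    "'a set \<Rightarrow> ('a \<Rightarrow> 'a \<Rightarrow> hyperbolic) \<Rightarrow> ('a \<Rightarrow> 'a) \<Rightarrow> bool"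
  where "D_Lipschitzian X d T \<longleftrightarrow> T \<in> X \<rightarrow> X \<and> (\<exists>k. D_Lipschitz_bound X d T k)"

text \<open>The Lipschitz constant is the \<open>\<preceq>\<close>-least bound in \<open>D_pos\<close>. It is unique if it exists,
  but need not exist (e.g. for a constant map), hence a relation rather than a function.\<close>

definition is_D_Lipschitz_constant ::
    "'a set \<Rightarrow> ('a \<Rightarrow> 'a \<Rightarrow> hyperbolic) \<Rightarrow> ('a \<Rightarrow> 'a) \<Rightarrow> hyperbolic \<Rightarrow> bool"
  where "is_D_Lipschitz_constant X d T k \<longleftrightarrow>
    D_Lipschitz_bound X d T k \<and> (\<forall>k'. D_Lipschitz_bound X d T k' \<longrightarrow> k \<preceq> k')"

definition D_contraction ::
    "'a set \<Rightarrow> ('a \<Rightarrow> 'a \<Rightarrow> hyperbolic) \<Rightarrow> ('a \<Rightarrow> 'a) \<Rightarrow> bool"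
  where "D_contraction X d T \<longleftrightarrow>
    D_Lipschitzian X d T \<and> (\<exists>k. is_D_Lipschitz_constant X d T k \<and> 0 \<prec> k \<and> k \<prec> 1)"

end

theory Submission imports Defs begin

text \<open>In the idempotent basis, order and arithmetic of the hyperbolic numbers are componentwise,
  so a hyperbolic metric is a pair of real pseudometrics on the same set, and \<open>T\<close> contracts each
  of them, by the corresponding component of \<open>k\<close>. A component alone need not separate points, nor
  need the set be complete for it: Banach's theorem cannot be applied to the two components
  separately. What does survive in each component are the metric estimates.

  All of them come from one inequality (\<open>dist_le_displacements\<close>): for a contraction with constant
  \<open>c < 1\<close>, the distance between two points is at most the sum of their displacements
  \<open>p x (T x)\<close> and \<open>p y (T y)\<close>, divided by \<open>1 - c\<close>. Displacements decay like \<open>c ^ n\<close> along an orbit.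
  Applied to two points of one orbit, the inequality shows that orbits are Cauchy
  (\<open>D_Cauchy_orbit\<close>); applied to two fixed points, whose displacements vanish, it gives
  uniqueness; applied to a point and a fixed point, it gives the error bound for
  \<open>n = 0\<close>, which \<open>n\<close> steps of contraction turn into the general one (\<open>dist_fixpoint_le\<close>), and
  thereby convergence of every orbit.

  Only where a point has to be produced or two points identified do the components act
  together: completeness yields a limit of an orbit in both components at once, its displacement
  vanishes in both because \<open>T\<close> is continuous for each, and hence it is fixed.\<close>

section \<open>Contractions of a real pseudometric\<close>

locale pseudometric_contraction =
  fixes X :: "'a set" and p :: "'a \<Rightarrow> 'a \<Rightarrow> real" and T :: "'a \<Rightarrow> 'a" and c :: real
  assumes nonneg: "x \<in> X \<Longrightarrow> y \<in> X \<Longrightarrow> 0 \<le> p x y"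
    and self: "x \<in> X \<Longrightarrow> p x x = 0"
    and sym: "x \<in> X \<Longrightarrow> y \<in> X \<Longrightarrow> p x y = p y x"
    and triangle: "x \<in> X \<Longrightarrow> y \<in> X \<Longrightarrow> z \<in> X \<Longrightarrow> p x y \<le> p x z + p z y"
    and maps: "x \<in> X \<Longrightarrow> T x \<in> X"
    and contracts: "x \<in> X \<Longrightarrow> y \<in> X \<Longrightarrow> p (T x) (T y) \<le> c * p x y"
    and c_pos: "0 < c" and c_less_1: "c < 1"
begin

lemma funpow_in: "x \<in> X \<Longrightarrow> (T ^^ n) x \<in> X"
  by (induction n) (auto intro: maps)

lemma funpow_contracts:
  assumes "x \<in> X" "y \<in> X"
  shows "p ((T ^^ n) x) ((T ^^ n) y) \<le> c ^ n * p x y"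
proof (induction n)
  case (Suc n)
  have "p ((T ^^ Suc n) x) ((T ^^ Suc n) y) \<le> c * p ((T ^^ n) x) ((T ^^ n) y)"
    using contracts funpow_in assms by simp
  also have "\<dots> \<le> c * (c ^ n * p x y)"
    using Suc c_pos by (intro mult_left_mono) auto
  finally show ?case by (simp add: mult.assoc)
qed simp

text \<open>Going from \<open>x\<close> to \<open>y\<close> through \<open>T x\<close> and \<open>T y\<close> costs both displacements and at most
  \<open>c * p x y\<close> in the middle; the last term is absorbed on the left.\<close>

lemma dist_le_displacements:
  assumes "x \<in> X" "y \<in> X"
  shows "p x y \<le> (p x (T x) + p y (T y)) / (1 - c)"
proof -
  have "p x y \<le> p x (T x) + p (T x) y"
    using triangle maps assms by blast
  moreover have "p (T x) y \<le> p (T x) (T y) + p (T y) y"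
    using triangle maps assms by blast
  moreover have "p (T x) (T y) \<le> c * p x y" "p (T y) y = p y (T y)"
    using contracts sym maps assms by auto
  ultimately have "p x y * (1 - c) \<le> p x (T x) + p y (T y)"
    by (simp add: algebra_simps)
  then show ?thesis
    using c_less_1 by (simp add: pos_le_divide_eq)
qed

lemma displacement_funpow_le:
  assumes "x \<in> X"
  shows "p ((T ^^ n) x) (T ((T ^^ n) x)) \<le> c ^ n * p x (T x)"
  using funpow_contracts[OF assms maps[OF assms], of n] by (simp add: funpow_swap1)

lemma orbit_dist_le:
  assumes "x \<in> X"
  shows "p ((T ^^ n) x) ((T ^^ m) x)
    \<le> c ^ n * (p x (T x) / (1 - c)) + c ^ m * (p x (T x) / (1 - c))"
proof -
  have "p ((T ^^ n) x) ((T ^^ m) x)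
      \<le> (p ((T ^^ n) x) (T ((T ^^ n) x)) + p ((T ^^ m) x) (T ((T ^^ m) x))) / (1 - c)"
    using dist_le_displacements funpow_in assms by blast
  also have "\<dots> \<le> (c ^ n * p x (T x) + c ^ m * p x (T x)) / (1 - c)"
    using displacement_funpow_le[OF assms] c_less_1
    by (intro divide_right_mono add_mono) auto
  finally show ?thesis by (simp add: add_divide_distrib)
qed

lemma dist_fixpoint_le:
  assumes "x \<in> X" "z \<in> X" "T z = z"
  shows "p ((T ^^ n) x) z \<le> c ^ n / (1 - c) * p x (T x)"
proof -
  have "(T ^^ n) z = z"
    using assms(3) by (induction n) auto
  then have "p ((T ^^ n) x) z \<le> c ^ n * p x z"
    using funpow_contracts[OF assms(1,2), of n] by simp
  also have "\<dots> \<le> c ^ n * (p x (T x) / (1 - c))"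
    using dist_le_displacements[OF assms(1,2)] self[OF assms(2)] assms(3) c_pos
    by (intro mult_left_mono) auto
  finally show ?thesis by simp
qed

lemma powers_tendsto_0: "(\<lambda>n. c ^ n * b) \<longlonglongrightarrow> 0"
  using tendsto_mult_left_zero[OF LIMSEQ_power_zero[of c]] c_pos c_less_1 by simp

text \<open>Continuity of \<open>T\<close> in sequential form: the shifted orbit approaches both \<open>z\<close> and \<open>T z\<close>.\<close>

lemma displacement_of_orbit_limit:
  assumes "x \<in> X" "z \<in> X" and lim: "(\<lambda>n. p ((T ^^ n) x) z) \<longlonglongrightarrow> 0"
  shows "p (T z) z = 0"
proof -
  have "p (T z) z \<le> c * p ((T ^^ n) x) z + p ((T ^^ Suc n) x) z" for n
  proof -
    have "p (T z) z \<le> p (T z) ((T ^^ Suc n) x) + p ((T ^^ Suc n) x) z"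
      using triangle maps funpow_in assms(1,2) by blast
    moreover have "p (T z) ((T ^^ Suc n) x) \<le> c * p z ((T ^^ n) x)"
      using contracts funpow_in assms(1,2) by simp
    ultimately show ?thesis
      using sym[OF assms(2) funpow_in[OF assms(1), of n]] by simp
  qed
  moreover have "(\<lambda>n. c * p ((T ^^ n) x) z + p ((T ^^ Suc n) x) z) \<longlonglongrightarrow> c * 0 + 0"
    by (intro tendsto_intros lim LIMSEQ_Suc[OF lim])
  ultimately have "p (T z) z \<le> 0"
    using LIMSEQ_le_const by fastforce
  then show ?thesis
    using nonneg maps assms(2) by (simp add: order_antisym)
qed

end

section \<open>Convergence in hyperbolic metrics, componentwise\<close>

lemma D_converges_imp_tendsto:
  assumes conv: "D_converges d s l" and nonneg: "\<And>n. d (s n) l \<in> D_nonneg"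
  shows "(\<lambda>n. comp1 (d (s n) l)) \<longlonglongrightarrow> 0" "(\<lambda>n. comp2 (d (s n) l)) \<longlonglongrightarrow> 0"
proof -
  have *: "\<exists>N. \<forall>n\<ge>N. comp1 (d (s n) l) < r \<and> comp2 (d (s n) l) < r" if "r > 0" for r :: real
  proof -
    have "r *\<^sub>R 1 \<in> D_pos"
      using that by (simp add: D_pos_def)
    then obtain N where "\<forall>n\<ge>N. d (s n) l \<prec> r *\<^sub>R 1"
      using conv unfolding D_converges_def by blast
    then show ?thesis
      by (auto simp: hyp_less_def)
  qed
  have abs_eq: "norm (comp1 (d (s n) l)) = comp1 (d (s n) l)"
      "norm (comp2 (d (s n) l)) = comp2 (d (s n) l)" for n
    using nonneg[of n] by (auto simp: D_nonneg_def)
  show "(\<lambda>n. comp1 (d (s n) l)) \<longlonglongrightarrow> 0" "(\<lambda>n. comp2 (d (s n) l)) \<longlonglongrightarrow> 0"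
    unfolding LIMSEQ_iff diff_0_right abs_eq using * by blast+
qed

lemma D_converges_by_bound:
  assumes bound: "\<And>n. comp1 (d (s n) l) \<le> u n" "\<And>n. comp2 (d (s n) l) \<le> v n"
    and lim: "u \<longlonglongrightarrow> 0" "v \<longlonglongrightarrow> 0"
  shows "D_converges d s l"
  unfolding D_converges_def
proof
  fix \<epsilon> :: hyperbolic assume "\<epsilon> \<in> D_pos"
  then have "\<forall>\<^sub>F n in sequentially. u n < comp1 \<epsilon>" "\<forall>\<^sub>F n in sequentially. v n < comp2 \<epsilon>"
    using lim by (auto simp: D_pos_def intro: order_tendstoD)
  then have "\<forall>\<^sub>F n in sequentially. d (s n) l \<prec> \<epsilon>"
    by eventually_elim (use bound in \<open>auto simp: hyp_less_def intro: le_less_trans\<close>)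
  then show "\<exists>N. \<forall>n\<ge>N. d (s n) l \<prec> \<epsilon>"
    by (simp add: eventually_sequentially)
qed

lemma D_Cauchy_by_bound:
  assumes bound: "\<And>n m. comp1 (d (s n) (s m)) \<le> u n + u m"
      "\<And>n m. comp2 (d (s n) (s m)) \<le> v n + v m"
    and lim: "u \<longlonglongrightarrow> 0" "v \<longlonglongrightarrow> 0"
  shows "D_Cauchy d s"
  unfolding D_Cauchy_def
proof
  fix \<epsilon> :: hyperbolic assume "\<epsilon> \<in> D_pos"
  then have "0 < comp1 \<epsilon> / 2" "0 < comp2 \<epsilon> / 2"
    by (simp_all add: D_pos_def)
  then have "\<forall>\<^sub>F n in sequentially. u n < comp1 \<epsilon> / 2" "\<forall>\<^sub>F n in sequentially. v n < comp2 \<epsilon> / 2"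
    using lim by (blast intro: order_tendstoD(2))+
  then have "\<forall>\<^sub>F n in sequentially. u n < comp1 \<epsilon> / 2 \<and> v n < comp2 \<epsilon> / 2"
    by eventually_elim simp
  then obtain N where N: "\<And>n. n \<ge> N \<Longrightarrow> u n < comp1 \<epsilon> / 2 \<and> v n < comp2 \<epsilon> / 2"
    by (auto simp: eventually_sequentially)
  have "d (s n) (s m) \<prec> \<epsilon>" if "n \<ge> N" "m \<ge> N" for n m
    using N[OF that(1)] N[OF that(2)] bound(1)[of n m] bound(2)[of n m]
    unfolding hyp_less_def by linarith
  then show "\<exists>N. \<forall>n\<ge>N. \<forall>m\<ge>N. d (s n) (s m) \<prec> \<epsilon>"
    by blast
qed

section \<open>Hyperbolic contractions\<close>

lemma pseudometric_contraction_components: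
  assumes "D_metric_space X d" "T \<in> X \<rightarrow> X" "D_Lipschitz_bound X d T k" "k \<prec> 1"
  shows "pseudometric_contraction X (\<lambda>x y. comp1 (d x y)) T (comp1 k)"
    and "pseudometric_contraction X (\<lambda>x y. comp2 (d x y)) T (comp2 k)"
proof -
  have nonneg: "0 \<le> comp1 (d x y)" "0 \<le> comp2 (d x y)"
    and sym: "comp1 (d x y) = comp1 (d y x)" "comp2 (d x y) = comp2 (d y x)"
    if "x \<in> X" "y \<in> X" for x y
  proof -
    have "d x y \<in> D_nonneg" "d x y = d y x"
      using assms(1) that unfolding D_metric_space_def by blast+
    then show "0 \<le> comp1 (d x y)" "0 \<le> comp2 (d x y)"
        "comp1 (d x y) = comp1 (d y x)" "comp2 (d x y) = comp2 (d y x)"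
      by (simp_all add: D_nonneg_def)
  qed
  have self: "comp1 (d x x) = 0" "comp2 (d x x) = 0" if "x \<in> X" for x
  proof -
    have "d x x = 0"
      using assms(1) that unfolding D_metric_space_def by blast
    then show "comp1 (d x x) = 0" "comp2 (d x x) = 0"
      by simp_all
  qed
  have maps: "T x \<in> X" if "x \<in> X" for x
    using assms(2) that by blast
  have triangle: "comp1 (d x y) \<le> comp1 (d x z) + comp1 (d z y)"
      "comp2 (d x y) \<le> comp2 (d x z) + comp2 (d z y)" if "x \<in> X" "y \<in> X" "z \<in> X" for x y z
    using assms(1) that by (auto simp: D_metric_space_def hyp_le_def)
  have contracts: "comp1 (d (T x) (T y)) \<le> comp1 k * comp1 (d x y)"
      "comp2 (d (T x) (T y)) \<le> comp2 k * comp2 (d x y)" if "x \<in> X" "y \<in> X" for x y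
    using assms(3) that by (auto simp: D_Lipschitz_bound_def hyp_le_def)
  have k: "0 < comp1 k" "0 < comp2 k" "comp1 k < 1" "comp2 k < 1"
    using assms(3,4) by (auto simp: D_Lipschitz_bound_def D_pos_def hyp_less_def)
  show "pseudometric_contraction X (\<lambda>x y. comp1 (d x y)) T (comp1 k)"
    by unfold_locales (fact nonneg self sym triangle maps contracts k)+
  show "pseudometric_contraction X (\<lambda>x y. comp2 (d x y)) T (comp2 k)"
    by unfold_locales (fact nonneg self sym triangle maps contracts k)+
qed

lemma D_Cauchy_orbit:
  assumes "D_metric_space X d" "T \<in> X \<rightarrow> X" "D_Lipschitz_bound X d T k" "k \<prec> 1" "x \<in> X"
  shows "D_Cauchy d (\<lambda>n. (T ^^ n) x)"
proof -
  interpret c1: pseudometric_contraction X "\<lambda>x y. comp1 (d x y)" T "comp1 k"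
    by (rule pseudometric_contraction_components[OF assms(1-4)])
  interpret c2: pseudometric_contraction X "\<lambda>x y. comp2 (d x y)" T "comp2 k"
    by (rule pseudometric_contraction_components[OF assms(1-4)])
  show ?thesis
    by (rule D_Cauchy_by_bound[where
          u = "\<lambda>n. comp1 k ^ n * (comp1 (d x (T x)) / (1 - comp1 k))" and
          v = "\<lambda>n. comp2 k ^ n * (comp2 (d x (T x)) / (1 - comp2 k))"])
      (intro c1.orbit_dist_le c2.orbit_dist_le c1.powers_tendsto_0 c2.powers_tendsto_0 assms(5))+
qed

theorem theorem30:
  fixes X :: "'a set" and d :: "'a \<Rightarrow> 'a \<Rightarrow> hyperbolic" and T :: "'a \<Rightarrow> 'a"
    and k :: hyperbolic
  assumes "D_metric_space X d"
    and "D_complete X d"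
    and "D_contraction X d T"
    and "is_D_Lipschitz_constant X d T k"
    and "0 \<prec> k" and "k \<prec> 1"
  shows "\<exists>x0\<in>X. T x0 = x0 \<and> (\<forall>y\<in>X. T y = y \<longrightarrow> y = x0) \<and>
           (\<forall>x\<in>X. D_converges d (\<lambda>n. (T ^^ n) x) x0) \<and>
           (\<forall>x\<in>X. \<forall>n. d ((T ^^ n) x) x0 \<preceq> (k ^ n / (1 - k)) * d x (T x))"
proof -
  have T: "T \<in> X \<rightarrow> X" and bound: "D_Lipschitz_bound X d T k"
    using assms(3,4)
    by (auto simp: D_contraction_def D_Lipschitzian_def is_D_Lipschitz_constant_def)
  interpret c1: pseudometric_contraction X "\<lambda>x y. comp1 (d x y)" T "comp1 k"
    by (rule pseudometric_contraction_components[OF assms(1) T bound assms(6)])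
  interpret c2: pseudometric_contraction X "\<lambda>x y. comp2 (d x y)" T "comp2 k"
    by (rule pseudometric_contraction_components[OF assms(1) T bound assms(6)])
  have "X \<noteq> {}"
    and nonneg: "\<And>x y. x \<in> X \<Longrightarrow> y \<in> X \<Longrightarrow> d x y \<in> D_nonneg"
    and zero_iff: "\<And>x y. x \<in> X \<Longrightarrow> y \<in> X \<Longrightarrow> d x y = 0 \<longleftrightarrow> x = y"
    using assms(1) by (auto simp: D_metric_space_def)

  from \<open>X \<noteq> {}\<close> obtain w where w: "w \<in> X" by blast
  have "range (\<lambda>n. (T ^^ n) w) \<subseteq> X"
    using c1.funpow_in[OF w] by auto
  then obtain x0 where x0: "x0 \<in> X" and conv: "D_converges d (\<lambda>n. (T ^^ n) w) x0"
    using assms(2) D_Cauchy_orbit[OF assms(1) T bound assms(6) w]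
    unfolding D_complete_def by blast

  note lims = D_converges_imp_tendsto[OF conv nonneg[OF c1.funpow_in[OF w] x0]]
  have "d (T x0) x0 = 0"
    using c1.displacement_of_orbit_limit[OF w x0 lims(1)]
      c2.displacement_of_orbit_limit[OF w x0 lims(2)]
    by (simp add: hyperbolic_eq_iff)
  then have fixed: "T x0 = x0"
    using zero_iff c1.maps x0 by blast

  have bound1: "comp1 (d ((T ^^ n) x) x0) \<le> comp1 k ^ n / (1 - comp1 k) * comp1 (d x (T x))"
    and bound2: "comp2 (d ((T ^^ n) x) x0) \<le> comp2 k ^ n / (1 - comp2 k) * comp2 (d x (T x))"
    if "x \<in> X" for x n
    using c1.dist_fixpoint_le[OF that x0 fixed] c2.dist_fixpoint_le[OF that x0 fixed] by auto
  have "d ((T ^^ n) x) x0 \<preceq> (k ^ n / (1 - k)) * d x (T x)" if "x \<in> X" for x n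
    using bound1[OF that] bound2[OF that] by (simp add: hyp_le_def)
  moreover have "D_converges d (\<lambda>n. (T ^^ n) x) x0" if "x \<in> X" for x
  proof (rule D_converges_by_bound)
    show "(\<lambda>n. comp1 k ^ n / (1 - comp1 k) * comp1 (d x (T x))) \<longlonglongrightarrow> 0"
      using c1.powers_tendsto_0[of "comp1 (d x (T x)) / (1 - comp1 k)"] by simp
    show "(\<lambda>n. comp2 k ^ n / (1 - comp2 k) * comp2 (d x (T x))) \<longlonglongrightarrow> 0"
      using c2.powers_tendsto_0[of "comp2 (d x (T x)) / (1 - comp2 k)"] by simp
  qed (fact bound1[OF that] bound2[OF that])+
  moreover have "y = x0" if "y \<in> X" "T y = y" for y
  proof -
    \<comment> \<open>The zeroth case of the error bound, for a point without displacement.\<close>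
    have "comp1 (d y x0) \<le> 0" "comp2 (d y x0) \<le> 0"
      using bound1[OF that(1), of 0] bound2[OF that(1), of 0] that(2)
        c1.self[OF that(1)] c2.self[OF that(1)] by simp_all
    then have "d y x0 = 0"
      using c1.nonneg[OF that(1) x0] c2.nonneg[OF that(1) x0]
      by (simp add: hyperbolic_eq_iff)
    then show ?thesis
      using zero_iff that(1) x0 by blast
  qed
  ultimately show ?thesis
    using x0 fixed by blast
qed

end
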